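(* There is an infinite word $\mathbf{w}$ over the ternary alphabet $\{0,1,2\}$ such that $\mathbf{w}$ is overlap-free and its curling-number transform $C(\mathbf{w})$ is $(7/3)^+$-free.
   Context: Words are indexed from $0$; infinite words are one-sided, $\mathbf{w} = \mathbf{w}[0]\mathbf{w}[1]\cdots$; $x[i..j]$ denotes the factor (contiguous block) $x[i]\cdots x[j]$. A finite word $x$ of length $n \ge 1$ has period $p$, $1\le p\le n$, if $x[i]=x[i+p]$ for all $0\le i<n-p$; its exponent is $n/p$ where $p$ is its least period. A finite or infinite word is $\alpha^+$-free if it has no nonempty finite factor of exponent strictly greater than $\alpha$. An overlap is a word of the form $a x a x a$ with $a$ a single letter and $x$ a possibly empty word; a word is overlap-free if it contains no overlap as a factor (equivalently, it is $2^+$-free). The curling number of a nonempty finite word $u$ is the largest integer $k \ge 1$ such that $u = y z^k$ for some (possibly empty) word $y$ and some nonempty word $z$. For a finite or infinite word $x$, the curling-number transform $C(x)$ is the word over the positive integers, of the same length as $x$, whose $i$-th letter $C(x)[i]$ is the curling number of the prefix $x[0..i]$. *)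

theory Defs
  imports Complex_Main "HOL-Library.Omega_Words_Fun"
begin

definition has_period :: "'a list \<Rightarrow> nat \<Rightarrow> bool" where
  "has_period x p \<longleftrightarrow>
     1 \<le> p \<and> p \<le> length x \<and> (\<forall>i. i + p < length x \<longrightarrow> x ! i = x ! (i + p))"

text \<open>The least period and the exponent are meaningful for nonempty words only, since
  the empty word has no period.\<close>

definition least_period :: "'a list \<Rightarrow> nat" where
  "least_period x = (LEAST p. has_period x p)"

definition exponent :: "'a list \<Rightarrow> real" where
  "exponent x = real (length x) / real (least_period x)"

text \<open>The factor \<^term>\<open>w [i \<rightarrow> j]\<close> is half-open: it consists of the letters at the
  positions from \<^term>\<open>i\<close> up to but excluding \<^term>\<open>j\<close>.\<close>

definition is_factor :: "'a list \<Rightarrow> 'a word \<Rightarrow> bool" where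
  "is_factor u w \<longleftrightarrow> (\<exists>i j. u = w [i \<rightarrow> j])"

definition plus_free :: "real \<Rightarrow> 'a word \<Rightarrow> bool" where
  "plus_free \<alpha> w \<longleftrightarrow> \<not> (\<exists>u. u \<noteq> [] \<and> is_factor u w \<and> exponent u > \<alpha>)"

definition is_overlap :: "'a list \<Rightarrow> bool" where
  "is_overlap u \<longleftrightarrow> (\<exists>a x. u = [a] @ x @ [a] @ x @ [a])"

definition overlap_free :: "'a word \<Rightarrow> bool" where
  "overlap_free w \<longleftrightarrow> \<not> (\<exists>u. is_factor u w \<and> is_overlap u)"

definition curling_decomp :: "'a list \<Rightarrow> nat \<Rightarrow> bool" where
  "curling_decomp u k \<longleftrightarrow> 1 \<le> k \<and> (\<exists>y z. z \<noteq> [] \<and> u = y @ concat (replicate k z))"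

definition curling_number :: "'a list \<Rightarrow> nat" where
  "curling_number u = (GREATEST k. curling_decomp u k)"

definition curling_transform :: "'a word \<Rightarrow> nat word" where
  "curling_transform w = (\<lambda>i. curling_number (w [0 \<rightarrow> Suc i]))"

text \<open>For nonempty words both extrema above are attained.\<close>

lemma has_period_least_period:
  assumes "x \<noteq> []"
  shows "has_period x (least_period x)"
proof -
  have "has_period x (length x)"
    using assms by (simp add: has_period_def Suc_le_eq)
  then show ?thesis
    unfolding least_period_def by (rule LeastI)
qed

lemma least_period_le: "has_period x p \<Longrightarrow> least_period x \<le> p"
  unfolding least_period_def by (rule Least_le)

lemma curling_decomp_le_length:
  assumes "curling_decomp u k"
  shows "k \<le> length u"
proof -
  obtain y z where z: "z \<noteq> []" and u: "u = y @ concat (replicate k z)"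
    using assms by (auto simp: curling_decomp_def)
  have "length u = length y + k * length z"
    using u by (simp add: length_concat sum_list_replicate)
  moreover have "k \<le> k * length z"
    using z by (cases z) auto
  ultimately show ?thesis by linarith
qed

lemma curling_decomp_curling_number:
  assumes "u \<noteq> []"
  shows "curling_decomp u (curling_number u)"
proof -
  have "u = [] @ concat (replicate 1 u)" by simp
  then have "curling_decomp u 1"
    using assms unfolding curling_decomp_def by blast
  then show ?thesis
    unfolding curling_number_def
    by (rule GreatestI_nat) (rule curling_decomp_le_length)
qed

lemma curling_number_ge: "curling_decomp u k \<Longrightarrow> k \<le> curling_number u"
  unfolding curling_number_def
  by (rule Greatest_le_nat) (auto intro: curling_decomp_le_length)

end

theory Submission
  imports Defs
begin

text \<open>The witness is the image of a squarefree ternary word, derived from the Thue--Morse word,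
  under a 16-uniform morphism. Its squares all have period at most \<open>4\<close>, and those ending in a
  given block can be detected inside that block, so its curling-number transform is
  the image of the same squarefree word under another 16-uniform morphism. In either image a
  repetition of large period has period divisible by \<open>16\<close>, because some short factors occur at one
  residue modulo \<open>16\<close> only, and so desubstitutes to a square. Only short periods remain, and
  these are visible in windows of four blocks.\<close>

section \<open>Repetitions and squarefree words\<close>

text \<open>\<open>r\<close> counts compared positions, so the factor described has length
  \<open>q + r\<close>: a square for \<open>r = q\<close>, an overlap for \<open>r = Suc q\<close>.
  The period \<open>q\<close> need not be the least one.\<close>

definition repeats :: "(nat \<Rightarrow> 'a) \<Rightarrow> nat \<Rightarrow> nat \<Rightarrow> nat \<Rightarrow> bool" where
  "repeats f q a r \<longleftrightarrow> (\<forall>k<r. f (a + k) = f (a + q + k))"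

definition squarefree_word :: "(nat \<Rightarrow> 'a) \<Rightarrow> bool" where
  "squarefree_word v \<longleftrightarrow> (\<forall>q>0. \<forall>a. \<not> repeats v q a q)"

lemma repeats_mono: "repeats f q a r \<Longrightarrow> s \<le> r \<Longrightarrow> repeats f q a s"
  by (auto simp: repeats_def)

lemma repeats_shift: "repeats f q a r \<Longrightarrow> d + s \<le> r \<Longrightarrow> repeats f q (a + d) s"
  unfolding repeats_def
proof (intro allI impI)
  fix k assume "\<forall>k<r. f (a + k) = f (a + q + k)" "d + s \<le> r" "k < s"
  then have "f (a + (d + k)) = f (a + q + (d + k))" by auto
  then show "f (a + d + k) = f (a + d + q + k)" by (simp add: add_ac)
qed

section \<open>A squarefree ternary word\<close>

fun thue_morse :: "nat \<Rightarrow> bool" where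
  "thue_morse n = (if n = 0 then False else thue_morse (n div 2) \<noteq> odd n)"

declare thue_morse.simps [simp del]

lemma thue_morse_double: "thue_morse (2 * n) = thue_morse n"
  by (cases "n = 0") (simp_all add: thue_morse.simps[of "2 * n"])

lemma thue_morse_Suc_double: "thue_morse (Suc (2 * n)) = (\<not> thue_morse n)"
  by (simp add: thue_morse.simps[of "Suc (2 * n)"])

lemma thue_morse_Suc_even: "even n \<Longrightarrow> thue_morse (Suc n) = (\<not> thue_morse n)"
  by (auto elim!: evenE simp: thue_morse_double thue_morse_Suc_double)

text \<open>For odd \<open>q\<close>, one of \<open>n\<close> and \<open>n + q\<close> is even, so the overlap would have to alternate
  on its second half; for even \<open>q\<close> one passes to every other letter.\<close>

lemma thue_morse_no_overlap: "0 < q \<Longrightarrow> \<not> repeats thue_morse q a (Suc q)"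
proof (induction q arbitrary: a rule: less_induct)
  case (less q)
  show ?case
  proof
    assume rep: "repeats thue_morse q a (Suc q)"
    have eq: "thue_morse n = thue_morse (n + q)" if "a \<le> n" "n \<le> a + q" for n
    proof -
      have "n - a < Suc q" using that by linarith
      then have "thue_morse (a + (n - a)) = thue_morse (a + q + (n - a))"
        using rep by (auto simp: repeats_def)
      moreover have "a + (n - a) = n" "a + q + (n - a) = n + q" using that by linarith+
      ultimately show ?thesis by simp
    qed
    show False
    proof (cases "even q")
      case True
      then obtain p where q: "q = 2 * p" by (elim evenE)
      have "repeats thue_morse p (a div 2) (Suc p)"
        unfolding repeats_def
      proof (intro allI impI)
        fix k assume k: "k < Suc p"
        show "thue_morse (a div 2 + k) = thue_morse (a div 2 + p + k)"
        proof (cases "even a")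
          case True
          then have "2 * (a div 2 + k) = a + 2 * k" by simp
          then have "thue_morse (2 * (a div 2 + k)) = thue_morse (2 * (a div 2 + k) + q)"
            using k q by (intro eq) auto
          also have "2 * (a div 2 + k) + q = 2 * (a div 2 + p + k)" using q by simp
          finally show ?thesis by (simp only: thue_morse_double)
        next
          case False
          then have "Suc (2 * (a div 2 + k)) = a + 2 * k" by presburger
          then have "thue_morse (Suc (2 * (a div 2 + k))) = thue_morse (Suc (2 * (a div 2 + k)) + q)"
            using k q by (intro eq) auto
          also have "Suc (2 * (a div 2 + k)) + q = Suc (2 * (a div 2 + p + k))" using q by simp
          finally show ?thesis by (simp only: thue_morse_Suc_double not_not simp_thms)
        qed
      qed
      moreover have "0 < p" "p < q" using q less.prems by auto
      ultimately show False using less.IH by blast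
    next
      case False
      have alt: "thue_morse (Suc n + q) = (\<not> thue_morse (n + q))" if "a \<le> n" "n < a + q" for n
      proof (cases "even n")
        case True
        then show ?thesis using eq[of n] eq[of "Suc n"] that thue_morse_Suc_even[of n] by auto
      next
        case odd: False
        then show ?thesis using False thue_morse_Suc_even[of "n + q"] by simp
      qed
      have "thue_morse (a + q + k) = (thue_morse (a + q) = even k)" if "k \<le> q" for k
        using that
      proof (induction k)
        case (Suc k)
        then show ?case using alt[of "a + k"] by (auto simp: algebra_simps)
      qed simp
      \<comment> \<open>After \<open>q\<close> alternations, \<open>q\<close> odd, the letter has
        flipped, whereas the last comparison of the overlap says that it is unchanged.\<close>
      from this[of q] False eq[of "a + q"] show False by simp
    qed
  qed
qed

text \<open>This is the ternary Thue-Morse word 2102012...; the shift by 1 keeps the differences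
  natural numbers.\<close>

definition ternary_tm :: "nat \<Rightarrow> nat" where
  "ternary_tm n =
    (if thue_morse n = thue_morse (Suc n) then 1 else if thue_morse n then 0 else 2)"

lemma ternary_tm_less: "ternary_tm n < 3"
  by (simp add: ternary_tm_def)

text \<open>The letters are the differences of consecutive Thue--Morse letters, so over each half of a
  square the Thue--Morse word changes by the same amount, which can only be \<open>0\<close>.\<close>

lemma squarefree_ternary_tm: "squarefree_word ternary_tm"
  unfolding squarefree_word_def
proof (intro allI impI notI)
  fix q a :: nat
  assume q: "0 < q" and rep: "repeats ternary_tm q a q"
  define s :: "nat \<Rightarrow> int" where "s n = of_bool (thue_morse n)" for n
  have step: "int (ternary_tm n) = s (Suc n) - s n + 1" for n
    by (auto simp: ternary_tm_def s_def)
  have diff: "s (a + k) - s a = s (a + q + k) - s (a + q)" if "k \<le> q" for k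
    using that
  proof (induction k)
    case (Suc k)
    then have "ternary_tm (a + k) = ternary_tm (a + q + k)"
      using rep by (auto simp: repeats_def)
    then show ?case using step[of "a + k"] step[of "a + q + k"] Suc by simp
  qed simp
  have "s (a + q) = s a"
    using diff[of q] by (auto simp: s_def of_bool_def split: if_splits)
  then have "s (a + k) = s (a + q + k)" if "k \<le> q" for k
    using diff[OF that] by simp
  then have "repeats thue_morse q a (Suc q)"
    by (auto simp: repeats_def s_def of_bool_eq_iff less_Suc_eq_le)
  then show False using thue_morse_no_overlap[OF q] by blast
qed

section \<open>Images under 16-uniform morphisms\<close>

definition morph :: "('a \<Rightarrow> 'b list) \<Rightarrow> (nat \<Rightarrow> 'a) \<Rightarrow> nat \<Rightarrow> 'b" where
  "morph g v n = g (v (n div 16)) ! (n mod 16)"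

lemma nth_concat_map_uniform:
  assumes "\<And>x. x \<in> set xs \<Longrightarrow> length (g x) = n" and "k < n * length xs"
  shows "concat (map g xs) ! k = g (xs ! (k div n)) ! (k mod n)"
  using assms
proof (induction xs arbitrary: k)
  case (Cons x xs)
  show ?case
  proof (cases "k < n")
    case True
    then show ?thesis using Cons.prems by (simp add: nth_append)
  next
    case False
    then have "0 < n" using Cons.prems(2) by (cases n) auto
    then have "k div n = Suc ((k - n) div n)" "k mod n = (k - n) mod n"
      using False by (simp_all add: le_div_geq le_mod_geq)
    moreover have "concat (map g xs) ! (k - n) = g (xs ! ((k - n) div n)) ! ((k - n) mod n)"
      using False Cons.prems by (intro Cons.IH) auto
    ultimately show ?thesis using False Cons.prems by (simp add: nth_append)
  qed
qed simp

lemma morph_block: "j < 16 \<Longrightarrow> morph g v (16 * n + j) = g (v n) ! j"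
  by (simp add: morph_def)

lemma morph_window:
  assumes "\<And>n. length (g (v n)) = 16" and "k < 16 * c"
  shows "morph g v (16 * b + k) = concat (map g (map v [b..<b + c])) ! k"
proof -
  have "k div 16 < c" using assms(2) by auto
  then show ?thesis using assms
    by (subst nth_concat_map_uniform[where n = 16]) (auto simp: morph_def)
qed

section \<open>Alignment of long periods with the blocks\<close>

definition synchronized :: "('a \<Rightarrow> 'b list) \<Rightarrow> (nat \<Rightarrow> 'a) \<Rightarrow> nat \<Rightarrow> nat \<Rightarrow> bool" where
  "synchronized g v \<rho> l \<longleftrightarrow> (\<forall>i j. i mod 16 = \<rho> \<longrightarrow>
     (\<forall>k<l. morph g v (i + k) = morph g v (j + k)) \<longrightarrow> j mod 16 = \<rho>)"

text \<open>Among the first 16 positions of the repetition one has residue \<open>\<rho>\<close>.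
  The \<open>l\<close> letters read there recur \<open>q\<close> positions later, which by
  synchronization is again a position of residue \<open>\<rho>\<close>. The bound
  \<open>15 + l\<close> leaves room for the worst start.\<close>

lemma synchronized_period:
  assumes sync: "synchronized g v \<rho> l" and "\<rho> < 16"
    and rep: "repeats (morph g v) q a r" and r: "15 + l \<le> r"
  shows "16 dvd q"
proof -
  \<comment> \<open>The distance from \<open>a\<close> to the next position of residue
    \<open>\<rho>\<close>; the added 16 keeps the truncated subtraction exact.\<close>
  define d where "d = (\<rho> + 16 - a mod 16) mod 16"
  have d: "d < 16" by (simp add: d_def)
  have ad: "(a + d) mod 16 = \<rho>"
  proof -
    have "a + (\<rho> + 16 - s) = \<rho> + 16 * Suc c" if "a = 16 * c + s" "s < 16" for c s
      using that by simp
    from this[of "a div 16" "a mod 16"]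
    have "(a + (\<rho> + 16 - a mod 16)) mod 16 = (\<rho> + 16 * Suc (a div 16)) mod 16" by simp
    also have "\<dots> = \<rho>" using \<open>\<rho> < 16\<close> by (simp only: mod_mult_self2 mod_less)
    finally show ?thesis by (simp only: d_def mod_add_right_eq)
  qed
  have "repeats (morph g v) q (a + d) l"
    using rep by (rule repeats_shift) (use r d in linarith)
  then have "\<forall>k<l. morph g v (a + d + k) = morph g v (a + d + q + k)"
    by (simp add: repeats_def)
  then have "(a + d + q) mod 16 = \<rho>"
    using sync ad by (auto simp: synchronized_def)
  with ad show ?thesis
    using mod_eq_dvd_iff_nat[of "a + d" "a + d + q" 16] by simp
qed

text \<open>In a repetition of period \<open>16 * m\<close> the inner blocks agree; the
  outer letters \<open>x\<close>, \<open>y\<close>, \<open>z\<close> of \<open>x u y u z\<close> agree in a suffix and a prefix only.\<close>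

definition rigid :: "('a \<Rightarrow> 'b list) \<Rightarrow> 'a set \<Rightarrow> nat \<Rightarrow> bool" where
  "rigid g A e \<longleftrightarrow> (\<forall>x\<in>A. \<forall>y\<in>A. \<forall>z\<in>A. \<forall>s<16.
     drop s (g x) = drop s (g y) \<longrightarrow> take (s + e) (g y) = take (s + e) (g z) \<longrightarrow> x = y \<or> y = z)"

text \<open>Block \<open>b + i\<close> is compared with block \<open>b + i + m\<close> for
  \<open>i\<close> from 0 to \<open>m\<close>: completely for the inner \<open>i\<close>, only on a
  suffix for \<open>i = 0\<close> and on a prefix for \<open>i = m\<close>. Rigidity makes one of
  the two outer comparisons an equality of letters, and \<open>m\<close> consecutive equalities form
  a square in \<open>v\<close>, starting at \<open>b\<close> or at \<open>Suc b\<close>.\<close>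

lemma morph_no_aligned_repeat:
  assumes v: "squarefree_word v" and A: "\<And>n. v n \<in> A" and len: "\<And>x. x \<in> A \<Longrightarrow> length (g x) = 16"
    and inj: "inj_on g A" and rigid: "rigid g A e" and m: "0 < m"
  shows "\<not> repeats (morph g v) (16 * m) a (16 * m + e)"
proof
  assume rep: "repeats (morph g v) (16 * m) a (16 * m + e)"
  define b s where "b = a div 16" and "s = a mod 16"
  have a: "a = 16 * b + s" and s: "s < 16" by (simp_all add: b_def s_def)
  have eq: "g (v (b + i)) ! j = g (v (b + i + m)) ! j"
    if "j < 16" "s \<le> 16 * i + j" "16 * i + j < s + 16 * m + e" for i j
  proof -
    have "16 * i + j - s < 16 * m + e" using that by linarith
    then have "morph g v (a + (16 * i + j - s)) = morph g v (a + 16 * m + (16 * i + j - s))"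
      using rep by (auto simp: repeats_def)
    moreover have "a + (16 * i + j - s) = 16 * (b + i) + j"
        "a + 16 * m + (16 * i + j - s) = 16 * (b + i + m) + j"
      using that(2) a by simp_all
    ultimately show ?thesis using that(1) by (simp only: morph_block)
  qed
  have inner: "v (b + i) = v (b + i + m)" if "0 < i" "i < m" for i
  proof -
    have "g (v (b + i)) = g (v (b + i + m))"
      using that s by (intro nth_equalityI) (auto simp: len A intro!: eq)
    then show ?thesis using inj A by (auto dest: inj_onD)
  qed
  have left: "drop s (g (v b)) = drop s (g (v (b + m)))"
  proof (intro nth_equalityI)
    fix j assume "j < length (drop s (g (v b)))"
    then show "drop s (g (v b)) ! j = drop s (g (v (b + m))) ! j"
      using eq[of "s + j" 0] m by (auto simp: len A)
  qed (simp add: len A)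
  have right: "take (s + e) (g (v (b + m))) = take (s + e) (g (v (b + m + m)))"
  proof (intro nth_equalityI)
    fix j assume "j < length (take (s + e) (g (v (b + m))))"
    then show "take (s + e) (g (v (b + m))) ! j = take (s + e) (g (v (b + m + m))) ! j"
      using eq[of j m] s m by (auto simp: len A)
  qed (simp add: len A)
  have "v b = v (b + m) \<or> v (b + m) = v (b + m + m)"
    using rigid A s left right unfolding rigid_def by blast
  then show False
  proof
    assume "v b = v (b + m)"
    then have "v (b + k) = v (b + m + k)" if "k < m" for k
      using inner[of k] that by (cases "k = 0") (auto simp: add_ac)
    then have "repeats v m b m" by (simp add: repeats_def)
    then show False using v m by (auto simp: squarefree_word_def)
  next
    assume last: "v (b + m) = v (b + m + m)"
    have "v (Suc b + k) = v (Suc b + m + k)" if "k < m" for k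
      using inner[of "Suc k"] that last by (cases "Suc k = m") (auto simp: add_ac)
    then have "repeats v m (Suc b) m" by (simp add: repeats_def)
    then show False using v m by (auto simp: squarefree_word_def)
  qed
qed

section \<open>Repetitions inside a bounded window\<close>

text \<open>The counter \<open>c\<close> is the length of the current run of \<open>True\<close>, so
  a single evaluable pass treats all starting positions at once.\<close>

fun run_free :: "nat \<Rightarrow> nat \<Rightarrow> bool list \<Rightarrow> bool" where
  "run_free r c [] = (c < r)"
| "run_free r c (b # bs) = (c < r \<and> run_free r (if b then Suc c else 0) bs)"

lemma run_free_prefix:
  "run_free r c bs \<Longrightarrow> d \<le> length bs \<Longrightarrow> \<forall>k<d. bs ! k \<Longrightarrow> c + d < r"
proof (induction bs arbitrary: c d)
  case (Cons b bs)
  show ?case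
  proof (cases d)
    case (Suc d')
    then have "b" and "\<forall>k<d'. bs ! k" using Cons.prems(3) by fastforce+
    then show ?thesis using Cons.IH[of "Suc c" d'] Cons.prems Suc by simp
  qed (use Cons.prems in simp)
qed simp

lemma run_freeD:
  "run_free r c bs \<Longrightarrow> a + d \<le> length bs \<Longrightarrow> \<forall>k<d. bs ! (a + k) \<Longrightarrow> d < r"
proof (induction a arbitrary: bs c)
  case 0
  then show ?case using run_free_prefix[of r c bs d] by simp
next
  case (Suc a)
  show ?case
  proof (cases bs)
    case (Cons b bs')
    then have "run_free r (if b then Suc c else 0) bs'" using Suc.prems(1) by simp
    then show ?thesis by (rule Suc.IH) (use Suc.prems Cons in simp_all)
  qed (use Suc.prems in simp)
qed

definition no_repeat :: "nat \<Rightarrow> nat \<Rightarrow> 'a list \<Rightarrow> bool" where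
  "no_repeat q r xs = run_free r 0 (map2 (=) xs (drop q xs))"

lemma no_repeatD:
  assumes "no_repeat q r xs" and "a + q + r \<le> length xs"
  shows "\<exists>k<r. xs ! (a + k) \<noteq> xs ! (a + q + k)"
proof (rule ccontr)
  assume "\<not> ?thesis"
  then have "\<forall>k<r. map2 (=) xs (drop q xs) ! (a + k)"
    using assms(2) by (auto simp: add_ac)
  then have "r < r"
    using assms by (intro run_freeD[of r 0 "map2 (=) xs (drop q xs)" a r]) (auto simp: no_repeat_def)
  then show False by simp
qed

section \<open>Windows of squarefree words\<close>

lemma squarefree_word_adjacent: "squarefree_word v \<Longrightarrow> v n \<noteq> v (Suc n)"
  unfolding squarefree_word_def repeats_def by (drule spec[of _ 1]) auto

text \<open>A square of length at most 4 has period 1 or 2, so the four conditions select exactly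
  the squarefree words.\<close>

definition squarefree4 :: "nat list list" where
  "squarefree4 = [xs \<leftarrow> List.n_lists 4 [0, 1, 2].
     (case xs of [x, y, z, t] \<Rightarrow> x \<noteq> y \<and> y \<noteq> z \<and> z \<noteq> t \<and> \<not> (x = z \<and> y = t) | _ \<Rightarrow> False)]"

lemma squarefree4_factor:
  assumes v: "squarefree_word v" and A: "\<And>n. v n \<in> {0, 1, 2}"
  shows "map v [b..<b + 4] \<in> set squarefree4"
proof -
  have window: "map v [b..<b + 4] = [v b, v (b + 1), v (b + 2), v (b + 3)]"
    by (simp add: upt_rec numeral_eq_Suc)
  have "\<not> repeats v 2 b 2" using v by (simp add: squarefree_word_def)
  then have "\<not> (v b = v (b + 2) \<and> v (b + 1) = v (b + 3))"
    by (auto simp: repeats_def less_Suc_eq numeral_eq_Suc)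
  moreover have "v b \<noteq> v (b + 1)" "v (b + 1) \<noteq> v (b + 2)" "v (b + 2) \<noteq> v (b + 3)"
    using squarefree_word_adjacent[OF v, of b] squarefree_word_adjacent[OF v, of "b + 1"]
      squarefree_word_adjacent[OF v, of "b + 2"] by (simp_all add: numeral_eq_Suc)
  moreover have "map v [b..<b + 4] \<in> set (List.n_lists 4 [0, 1, 2])"
  proof -
    have "set (map v [b..<b + 4]) \<subseteq> set [0, 1, 2]" using A by force
    then show ?thesis by (simp only: set_n_lists) simp
  qed
  ultimately show ?thesis by (simp add: squarefree4_def window)
qed

text \<open>The repetition starts at an offset of at most 15 in its first block, and 15 + 49 = 64 is
  the length of four blocks.\<close>

lemma morph_no_short_repeat:
  assumes v: "squarefree_word v" and A: "\<And>n. v n \<in> {0, 1, 2}"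
    and len: "\<And>n. length (g (v n)) = 16"
    and check: "\<forall>xs\<in>set squarefree4. no_repeat q r (concat (map g xs))"
    and bound: "q + r \<le> 49"
  shows "\<not> repeats (morph g v) q a r"
proof
  assume rep: "repeats (morph g v) q a r"
  define b s where "b = a div 16" and "s = a mod 16"
  have a: "a = 16 * b + s" and s: "s < 16" by (simp_all add: b_def s_def)
  define X where "X = concat (map g (map v [b..<b + 4]))"
  have X: "morph g v (16 * b + k) = X ! k" if "k < 64" for k
    unfolding X_def using that len by (intro morph_window) auto
  have "length X = 64"
    by (simp add: X_def length_concat o_def len sum_list_triv upt_rec numeral_eq_Suc)
  moreover have "no_repeat q r X"
    unfolding X_def using check squarefree4_factor[OF v A] by blast
  ultimately obtain k where k: "k < r" "X ! (s + k) \<noteq> X ! (s + q + k)"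
    using no_repeatD[of q r X s] s bound by auto
  have "morph g v (a + k) = X ! (s + k)" "morph g v (a + q + k) = X ! (s + q + k)"
    using X[of "s + k"] X[of "s + q + k"] k(1) s bound by (simp_all add: a add_ac)
  with k rep show False by (auto simp: repeats_def)
qed

definition adjacent_pairs :: "nat list list" where
  "adjacent_pairs = [xs \<leftarrow> List.n_lists 2 [0, 1, 2]. xs ! 0 \<noteq> xs ! 1]"

lemma adjacent_pairs_factor:
  assumes v: "squarefree_word v" and A: "\<And>n. v n \<in> {0, 1, 2}"
  shows "map v [b..<b + 2] \<in> set adjacent_pairs"
proof -
  have "set (map v [b..<b + 2]) \<subseteq> set [0, 1, 2]" using A by force
  then have "map v [b..<b + 2] \<in> set (List.n_lists 2 [0, 1, 2])"
    by (simp only: set_n_lists) simp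
  then show ?thesis
    using squarefree_word_adjacent[OF v, of b] by (simp add: adjacent_pairs_def)
qed

definition sync_check :: "(nat \<Rightarrow> 'b list) \<Rightarrow> nat \<Rightarrow> nat \<Rightarrow> bool" where
  "sync_check g \<rho> l \<longleftrightarrow> (\<forall>xs\<in>set adjacent_pairs. \<forall>ys\<in>set adjacent_pairs. \<forall>s\<in>set [0..<16].
     take l (drop \<rho> (concat (map g xs))) = take l (drop s (concat (map g ys))) \<longrightarrow> s = \<rho>)"

text \<open>A factor of length at most 16 lies within the block where it starts and the next one, so
  comparing images of adjacent pairs suffices.\<close>

lemma synchronizedI:
  assumes v: "squarefree_word v" and A: "\<And>n. v n \<in> {0, 1, 2}"
    and len: "\<And>n. length (g (v n)) = 16"
    and check: "sync_check g \<rho> l" and bounds: "\<rho> < 16" "l \<le> 16"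
  shows "synchronized g v \<rho> l"
  unfolding synchronized_def
proof (intro allI impI)
  fix i j assume i: "i mod 16 = \<rho>"
    and eq: "\<forall>k<l. morph g v (i + k) = morph g v (j + k)"
  define W where "W n = concat (map g (map v [n div 16..<n div 16 + 2]))" for n
  have length_W: "length (W n) = 32" for n
    by (simp add: W_def length_concat o_def len upt_rec)
  have W: "morph g v (n + k) = W n ! (n mod 16 + k)" if "k < l" for n k
  proof -
    have "morph g v (16 * (n div 16) + (n mod 16 + k)) = W n ! (n mod 16 + k)"
      unfolding W_def using that bounds len mod_less_divisor[of 16 n]
      by (intro morph_window) auto
    then show ?thesis by (simp add: add.assoc[symmetric])
  qed
  have "take l (drop (i mod 16) (W i)) = take l (drop (j mod 16) (W j))"
  proof (intro nth_equalityI)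
    fix k assume "k < length (take l (drop (i mod 16) (W i)))"
    then have "k < l" by simp
    then show "take l (drop (i mod 16) (W i)) ! k = take l (drop (j mod 16) (W j)) ! k"
      using eq W[of k i] W[of k j] mod_less_divisor[of 16 i] mod_less_divisor[of 16 j] bounds
      by (simp add: length_W)
  qed (use mod_less_divisor[of 16 i] mod_less_divisor[of 16 j] bounds in \<open>simp add: length_W\<close>)
  moreover have "map v [n..<n + 2] \<in> set adjacent_pairs" for n
    by (rule adjacent_pairs_factor[OF v A])
  moreover have "j mod 16 \<in> set [0..<16]" by simp
  ultimately show "j mod 16 = \<rho>"
    using check i unfolding sync_check_def W_def by blast
qed

section \<open>Curling numbers of overlap-free words\<close>

lemma nth_concat_replicate:
  "k < n * length z \<Longrightarrow> concat (replicate n z) ! k = z ! (k mod length z)"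
proof (induction n arbitrary: k)
  case (Suc n)
  show ?case
  proof (cases "k < length z")
    case False
    then have "concat (replicate n z) ! (k - length z) = z ! ((k - length z) mod length z)"
      using Suc.prems by (intro Suc.IH) auto
    then show ?thesis using False by (simp add: nth_append le_mod_geq)
  qed (simp add: nth_append)
qed simp

text \<open>With \<open>q\<close> the length of \<open>z\<close>, a final power of
  \<open>Suc k\<close> copies of \<open>z\<close> agrees with its shift by \<open>q\<close> along
  all but its last copy.\<close>

lemma curling_decomp_repeats:
  assumes "curling_decomp (f [0 \<rightarrow> n]) (Suc k)"
  shows "\<exists>q>0. Suc k * q \<le> n \<and> repeats f q (n - Suc k * q) (k * q)"
proof -
  obtain y z where z: "z \<noteq> []" and u: "f [0 \<rightarrow> n] = y @ concat (replicate (Suc k) z)"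
    using assms by (auto simp: curling_decomp_def)
  define q where "q = length z"
  have q: "0 < q" using z by (simp add: q_def)
  have n: "n = length y + Suc k * q"
    using arg_cong[OF u, of length]
    by (simp add: q_def length_concat sum_list_replicate)
  have f: "f (length y + i) = z ! (i mod q)" if "i < Suc k * q" for i
  proof -
    have "f (length y + i) = (y @ concat (replicate (Suc k) z)) ! (length y + i)"
      using arg_cong[OF u, of "\<lambda>xs. xs ! (length y + i)"] that n by simp
    also have "\<dots> = z ! (i mod q)"
      using that nth_concat_replicate[of i "Suc k" z] by (simp add: q_def)
    finally show ?thesis .
  qed
  have "repeats f q (length y) (k * q)"
    unfolding repeats_def
  proof (intro allI impI)
    fix i assume "i < k * q"
    then show "f (length y + i) = f (length y + q + i)"
      using f[of i] f[of "q + i"] by (simp add: add.assoc)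
  qed
  then show ?thesis using q n by auto
qed

text \<open>A cube contains an overlap, so only the values 1 and 2 remain, and 2 means that the
  prefix ends in a square.\<close>

lemma curling_number_overlap_free:
  assumes ov: "\<And>q a. 0 < q \<Longrightarrow> \<not> repeats f q a (Suc q)" and n: "0 < n"
  shows "curling_number (f [0 \<rightarrow> n]) =
    (if \<exists>q>0. 2 * q \<le> n \<and> repeats f q (n - 2 * q) q then 2 else 1)"
proof -
  define c where "c = curling_number (f [0 \<rightarrow> n])"
  have c: "curling_decomp (f [0 \<rightarrow> n]) c"
    unfolding c_def using n by (intro curling_decomp_curling_number) auto
  then have "1 \<le> c" by (simp add: curling_decomp_def)
  have "c \<le> 2"
  proof (rule ccontr)
    assume "\<not> c \<le> 2"
    then obtain k where k: "c = Suc k" "2 \<le> k" by (cases c) auto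
    then obtain q where q: "0 < q" "repeats f q (n - Suc k * q) (k * q)"
      using c curling_decomp_repeats by blast
    have "Suc q \<le> 2 * q" using q(1) by simp
    also have "\<dots> \<le> k * q" using k(2) by simp
    finally show False using ov q repeats_mono by blast
  qed
  have "\<exists>q>0. 2 * q \<le> n \<and> repeats f q (n - 2 * q) q" if "c = 2"
    using curling_decomp_repeats[of f n 1] c that by (simp add: numeral_2_eq_2)
  moreover have "2 \<le> c" if q: "0 < q" "2 * q \<le> n" and rep: "repeats f q (n - 2 * q) q" for q
  proof -
    define z where "z = f [n - q \<rightarrow> n]"
    have "f [n - 2 * q \<rightarrow> n - q] = z"
      using q rep by (intro nth_equalityI) (auto simp: z_def repeats_def)
    then have "f [0 \<rightarrow> n] = f [0 \<rightarrow> n - 2 * q] @ z @ z"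
    proof -
      have "[0..<n] = [0..<n - 2 * q] @ [n - 2 * q..<n - q] @ [n - q..<n]"
        using q upt_add_eq_append[of 0 "n - 2 * q" "2 * q"]
          upt_add_eq_append[of "n - 2 * q" "n - q" q] by simp
      then show ?thesis
        using \<open>f [n - 2 * q \<rightarrow> n - q] = z\<close> by (simp add: subsequence_def z_def)
    qed
    moreover have "z \<noteq> []" using q by (simp add: z_def)
    ultimately have "curling_decomp (f [0 \<rightarrow> n]) 2"
      unfolding curling_decomp_def by (intro conjI exI[of _ "f [0 \<rightarrow> n - 2 * q]"] exI[of _ z])
        (auto simp: numeral_2_eq_2)
    then show ?thesis unfolding c_def by (rule curling_number_ge)
  qed
  ultimately show ?thesis
    using \<open>1 \<le> c\<close> \<open>c \<le> 2\<close> unfolding c_def[symmetric] by (auto; force)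
qed

definition ends_in_short_square :: "'a list \<Rightarrow> bool" where
  "ends_in_short_square xs \<longleftrightarrow> (\<exists>q\<in>set [1, 2, 3, 4]. 2 * q \<le> length xs \<and>
     take q (drop (length xs - 2 * q) xs) = drop (length xs - q) xs)"

text \<open>By \<open>short\<close>, a final square has period at most 4, hence length at most 8. It
  therefore fits into \<open>xs\<close>, which is either the whole prefix or a suffix of at least 8
  letters.\<close>

lemma curling_number_local:
  assumes ov: "\<And>q a. 0 < q \<Longrightarrow> \<not> repeats f q a (Suc q)"
    and short: "\<And>q a. 5 \<le> q \<Longrightarrow> \<not> repeats f q a q"
    and xs: "\<And>k. k < length xs \<Longrightarrow> f (b + k) = xs ! k"
    and long: "xs \<noteq> []" "b = 0 \<or> 8 \<le> length xs"
  shows "curling_number (f [0 \<rightarrow> b + length xs]) = (if ends_in_short_square xs then 2 else 1)"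
proof -
  let ?n = "b + length xs"
  have block: "repeats f q (?n - 2 * q) q \<longleftrightarrow>
      take q (drop (length xs - 2 * q) xs) = drop (length xs - q) xs" if "2 * q \<le> length xs" for q
  proof -
    have l: "f (?n - 2 * q + k) = xs ! (length xs - 2 * q + k)"
      and r: "f (?n - 2 * q + q + k) = xs ! (length xs - q + k)" if "k < q" for k
      using xs[of "length xs - 2 * q + k"] xs[of "length xs - q + k"] that \<open>2 * q \<le> length xs\<close>
      by (simp_all add: algebra_simps)
    show ?thesis
      using that l r by (auto simp: repeats_def list_eq_iff_nth_eq)
  qed
  have "(\<exists>q>0. 2 * q \<le> ?n \<and> repeats f q (?n - 2 * q) q) \<longleftrightarrow>
      (\<exists>q\<in>set [1, 2, 3, 4]. 2 * q \<le> length xs \<and> repeats f q (?n - 2 * q) q)" (is "?L \<longleftrightarrow> ?R")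
  proof
    assume ?L
    then obtain q where q: "0 < q" "2 * q \<le> ?n" "repeats f q (?n - 2 * q) q" by blast
    then have "q < 5" using short[of q] by (meson not_le)
    then have "q \<in> set [1, 2, 3, 4]" using q(1) by auto
    moreover have "2 * q \<le> length xs" using long(2) q(2) \<open>q < 5\<close> by auto
    ultimately show ?R using q(3) by blast
  next
    assume ?R
    then obtain q where q: "q \<in> set [1, 2, 3, 4]" "2 * q \<le> length xs" "repeats f q (?n - 2 * q) q"
      by blast
    moreover have "0 < q" using q(1) by auto
    ultimately show ?L by (intro exI[of _ q]) auto
  qed
  also have "\<dots> \<longleftrightarrow> ends_in_short_square xs"
    unfolding ends_in_short_square_def using block by blast
  finally show ?thesis
    using curling_number_overlap_free[OF ov, of ?n] long(1) by simp
qed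

section \<open>Translation to factors\<close>

lemma overlap_freeI:
  assumes "\<And>q a. 0 < q \<Longrightarrow> \<not> repeats f q a (Suc q)"
  shows "overlap_free f"
  unfolding overlap_free_def
proof
  assume "\<exists>u. is_factor u f \<and> is_overlap u"
  then obtain i j c x where u: "f [i \<rightarrow> j] = [c] @ x @ [c] @ x @ [c]"
    by (auto simp: is_factor_def is_overlap_def)
  define q where "q = Suc (length x)"
  have len: "j - i = 2 * q + 1"
    using arg_cong[OF u, of length] by (simp add: q_def)
  have "repeats f q i (Suc q)"
    unfolding repeats_def
  proof (intro allI impI)
    fix k assume k: "k < Suc q"
    have f: "f (i + m) = ([c] @ x @ [c] @ x @ [c]) ! m" if "m < 2 * q + 1" for m
      using arg_cong[OF u, of "\<lambda>xs. xs ! m"] that len by simp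
    \<comment> \<open>The compared position carries the first \<open>c\<close>, the middle
      \<open>c\<close>, or a letter of the first \<open>x\<close>.\<close>
    have "k = 0 \<or> k = q \<or> (\<exists>m < length x. k = Suc m)"
      using k by (cases k) (auto simp: q_def)
    then have "([c] @ x @ [c] @ x @ [c]) ! k = ([c] @ x @ [c] @ x @ [c]) ! (q + k)"
      by (auto simp: q_def nth_append)
    then show "f (i + k) = f (i + q + k)"
      using f[of k] f[of "q + k"] k by (simp add: add.assoc)
  qed
  then show False using assms[of q i] by (simp add: q_def)
qed

text \<open>Taking \<open>q\<close> as the least period and \<open>r\<close> as the length minus
  \<open>q\<close>, an exponent above \<open>\<alpha>\<close> says that \<open>r\<close> exceeds
  \<open>(\<alpha> - 1) * q\<close>.\<close>

lemma plus_freeI: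
  assumes "\<And>q a r. 0 < q \<Longrightarrow> (\<alpha> - 1) * real q < real r \<Longrightarrow> \<not> repeats f q a r"
  shows "plus_free \<alpha> f"
  unfolding plus_free_def
proof
  assume "\<exists>u. u \<noteq> [] \<and> is_factor u f \<and> \<alpha> < exponent u"
  then obtain i j where ne: "f [i \<rightarrow> j] \<noteq> []" and ex: "\<alpha> < exponent (f [i \<rightarrow> j])"
    by (auto simp: is_factor_def)
  define q where "q = least_period (f [i \<rightarrow> j])"
  have per: "has_period (f [i \<rightarrow> j]) q"
    unfolding q_def using ne by (rule has_period_least_period)
  then have q: "0 < q" "q \<le> j - i" by (auto simp: has_period_def)
  have "repeats f q i (j - i - q)"
    unfolding repeats_def
  proof (intro allI impI)
    fix k assume "k < j - i - q"
    then have k: "k + q < j - i" by linarith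
    then have "f [i \<rightarrow> j] ! k = f [i \<rightarrow> j] ! (k + q)"
      using per by (simp add: has_period_def)
    then show "f (i + k) = f (i + q + k)" using k by (simp add: add_ac)
  qed
  moreover have "(\<alpha> - 1) * real q < real (j - i - q)"
  proof -
    have "\<alpha> * real q < real (j - i)"
      using ex q by (simp add: exponent_def q_def[symmetric] pos_less_divide_eq)
    then show ?thesis using q by (simp add: of_nat_diff algebra_simps)
  qed
  ultimately show False using assms q(1) by blast
qed

section \<open>The word\<close>

text \<open>The blocks were found by computer search, requiring that for each of them the curling numbers
  of its own prefixes equal the curling numbers at these positions in every image word.\<close>

definition image_block :: "nat \<Rightarrow> nat list" where
  "image_block n =
    (if n = 0 then [0,0,1,0,0,1,2,0,0,1,2,2,0,2,0,0]
     else if n = 1 then [1,1,2,1,2,2,1,2,1,0,1,0,2,0,2,2]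
     else [1,1,2,1,2,2,1,2,1,0,1,1,0,1,0,2])"

definition curling_block :: "nat \<Rightarrow> nat list" where
  "curling_block n =
    (if n = 0 then [1,2,1,1,2,2,1,1,2,1,2,2,1,1,2,2]
     else if n = 1 then [1,2,1,1,2,2,1,2,2,1,1,2,1,1,2,2]
     else [1,2,1,1,2,2,1,2,2,1,1,2,1,2,2,1])"

abbreviation tm_image :: "nat \<Rightarrow> nat" where
  "tm_image \<equiv> morph image_block ternary_tm"

lemma ternary_tm_in: "ternary_tm n \<in> {0, 1, 2}"
  using ternary_tm_less[of n] by auto

lemma length_blocks: "length (image_block n) = 16" "length (curling_block n) = 16"
  by (simp_all add: image_block_def curling_block_def)

section \<open>Finite checks on the blocks\<close>

text \<open>The blocks begin with 0010 or 1121, and these factors occur only at block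
  starts.\<close>

lemma sync_image: "sync_check image_block 0 4"
  by code_simp

text \<open>The markers are 1122112 and 1122122. Residue 0 would fail at this length: the block of 1
  ends in 121122 and the next block begins with 1, so the common prefix 1211221 also occurs at
  residue 10.\<close>

lemma sync_curling: "sync_check curling_block 2 7"
  by code_simp

lemma rigid_image: "rigid image_block {0, 1, 2} 0"
proof -
  have "\<forall>x\<in>set [0, 1, 2]. \<forall>y\<in>set [0, 1, 2]. \<forall>z\<in>set [0, 1, 2]. \<forall>s\<in>set [0..<16].
     drop s (image_block x) = drop s (image_block y) \<longrightarrow>
     take (s + 0) (image_block y) = take (s + 0) (image_block z) \<longrightarrow> x = y \<or> y = z"
    by code_simp
  then show ?thesis by (simp only: rigid_def set_upt atLeastLessThan_iff list.set) simp
qed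

text \<open>The excess 6 comes from period 16: the least \<open>r\<close> with 4 * 16 < 3 *
  \<open>r\<close> is 22 = 16 + 6. Larger multiples of 16 give at least as much.\<close>

lemma rigid_curling: "rigid curling_block {0, 1, 2} 6"
proof -
  have "\<forall>x\<in>set [0, 1, 2]. \<forall>y\<in>set [0, 1, 2]. \<forall>z\<in>set [0, 1, 2]. \<forall>s\<in>set [0..<16].
     drop s (curling_block x) = drop s (curling_block y) \<longrightarrow>
     take (s + 6) (curling_block y) = take (s + 6) (curling_block z) \<longrightarrow> x = y \<or> y = z"
    by code_simp
  then show ?thesis by (simp only: rigid_def set_upt atLeastLessThan_iff list.set) simp
qed

lemma inj_blocks: "inj_on image_block {0, 1, 2}" "inj_on curling_block {0, 1, 2}"
  by (simp_all add: inj_on_def image_block_def curling_block_def)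

text \<open>From period 19 = 15 + 4 on, a square is long enough for
  \<open>synchronized_period\<close> with the markers of length 4.\<close>

lemma no_short_square_image:
  "\<forall>q\<in>set [5..<19]. \<forall>xs\<in>set squarefree4. no_repeat q q (concat (map image_block xs))"
  by code_simp

lemma no_short_overlap_image:
  "\<forall>q\<in>set [1..<5]. \<forall>xs\<in>set squarefree4. no_repeat q (Suc q) (concat (map image_block xs))"
  by code_simp

text \<open>\<open>Suc (4 * q div 3)\<close> is the least \<open>r\<close> with
  \<open>4 * q < 3 * r\<close>, that is, the first excess giving \<open>(q + r) / q\<close> above
  7/3.\<close>

lemma no_short_repeat_curling:
  "\<forall>q\<in>set [1..<16]. \<forall>xs\<in>set squarefree4.
     no_repeat q (Suc (4 * q div 3)) (concat (map curling_block xs))"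
  by code_simp

lemma curling_block_first:
  "\<forall>x\<in>set [0, 1, 2]. \<forall>k\<in>set [0..<16].
     (if ends_in_short_square (take (Suc k) (image_block x)) then 2 else 1) = curling_block x ! k"
  by code_simp

text \<open>The values depend on the second letter of the pair only: the preceding block never
  changes the curling numbers.\<close>

lemma curling_block_next:
  "\<forall>xs\<in>set adjacent_pairs. \<forall>k\<in>set [0..<16].
     (if ends_in_short_square (take (16 + Suc k) (concat (map image_block xs))) then 2 else 1)
       = curling_block (xs ! 1) ! k"
  by code_simp

section \<open>Repetitions in the image word and in its transform\<close>

lemma tm_image_no_square:
  assumes "5 \<le> q"
  shows "\<not> repeats tm_image q a q"
proof (cases "q < 19")
  case True
  then have "q \<in> set [5..<19]" using assms by (simp only: set_upt atLeastLessThan_iff)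
  then show ?thesis
    using True
    by (intro morph_no_short_repeat[OF squarefree_ternary_tm ternary_tm_in length_blocks(1)
          bspec[OF no_short_square_image]]) simp_all
next
  case False
  show ?thesis
  proof
    assume rep: "repeats tm_image q a q"
    have "synchronized image_block ternary_tm 0 4"
      by (rule synchronizedI[OF squarefree_ternary_tm ternary_tm_in length_blocks(1) sync_image])
        simp_all
    then have "16 dvd q"
      by (rule synchronized_period[OF _ _ rep]) (use False in simp_all)
    then obtain m where m: "q = 16 * m" by (elim dvdE)
    then show False
      using morph_no_aligned_repeat[OF squarefree_ternary_tm ternary_tm_in length_blocks(1)
          inj_blocks(1) rigid_image, of m a] rep False by simp
  qed
qed

lemma tm_image_no_overlap:
  assumes "0 < q"
  shows "\<not> repeats tm_image q a (Suc q)"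
proof (cases "q < 5")
  case True
  then have "q \<in> set [1..<5]" using assms by simp
  then show ?thesis
    using True
    by (intro morph_no_short_repeat[OF squarefree_ternary_tm ternary_tm_in length_blocks(1)
          bspec[OF no_short_overlap_image]]) simp_all
next
  case False
  then show ?thesis
    using tm_image_no_square[of q a] repeats_mono[of tm_image q a "Suc q" q] by auto
qed

lemma curling_transform_tm_image: "curling_transform tm_image = morph curling_block ternary_tm"
proof
  fix i :: nat
  define b k where "b = i div 16" and "k = i mod 16"
  have i: "i = 16 * b + k" and k: "k < 16" by (simp_all add: b_def k_def)
  have rhs: "morph curling_block ternary_tm i = curling_block (ternary_tm b) ! k"
    by (simp add: i k morph_block)
  show "curling_transform tm_image i = morph curling_block ternary_tm i"
  \<comment> \<open>The first block has no predecessor and is read alone; any later block is read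
    together with the block before it, which gives at least 17 letters, enough for squares of length
    at most 8.\<close>
  proof (cases b)
    case 0
    define X where "X = take (Suc k) (image_block (ternary_tm 0))"
    have X: "length X = Suc k" using k by (simp add: X_def length_blocks)
    have "curling_number (tm_image [0 \<rightarrow> 0 + length X]) = (if ends_in_short_square X then 2 else 1)"
    proof (rule curling_number_local)
      show "tm_image (0 + n) = X ! n" if "n < length X" for n
        using that k X morph_block[of n image_block ternary_tm 0] by (simp add: X_def)
    qed (use X in \<open>auto simp: tm_image_no_square tm_image_no_overlap\<close>)
    also have "\<dots> = curling_block (ternary_tm 0) ! k"
      unfolding X_def using ternary_tm_in[of 0] k
      by (intro curling_block_first[rule_format]) simp_all
    finally have "curling_number (tm_image [0 \<rightarrow> 0 + length X]) = curling_block (ternary_tm 0) ! k" .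
    moreover have "0 + length X = Suc i" using 0 X i by simp
    ultimately show ?thesis using rhs 0 by (simp only: curling_transform_def)
  next
    case (Suc c)
    define P where "P = map ternary_tm [c..<c + 2]"
    have P: "P \<in> set adjacent_pairs"
      unfolding P_def by (rule adjacent_pairs_factor[OF squarefree_ternary_tm ternary_tm_in])
    define X where "X = take (16 + Suc k) (concat (map image_block P))"
    have X: "length X = 16 + Suc k"
      using k by (simp add: X_def P_def length_concat o_def length_blocks upt_rec)
    have "curling_number (tm_image [0 \<rightarrow> 16 * c + length X])
        = (if ends_in_short_square X then 2 else 1)"
    proof (rule curling_number_local)
      show "tm_image (16 * c + n) = X ! n" if "n < length X" for n
      proof -
        have "tm_image (16 * c + n) = concat (map image_block P) ! n"
          unfolding P_def using that k X by (intro morph_window) (simp_all add: length_blocks)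
        then show ?thesis using that X by (simp add: X_def)
      qed
    qed (use X in \<open>auto simp: tm_image_no_square tm_image_no_overlap\<close>)
    also have "\<dots> = curling_block (P ! 1) ! k"
      unfolding X_def using P k by (intro curling_block_next[rule_format]) simp_all
    finally have "curling_number (tm_image [0 \<rightarrow> 16 * c + length X]) = curling_block (P ! 1) ! k" .
    moreover have "P ! 1 = ternary_tm b" by (simp add: P_def Suc)
    moreover have "16 * c + length X = Suc i" using Suc X i by simp
    ultimately show ?thesis using rhs by (simp only: curling_transform_def)
  qed
qed

text \<open>The hypothesis \<open>r\<close> says that \<open>(q + r) / q\<close> exceeds 7/3.
  Periods below 16 are covered by the window check; for the others \<open>r\<close> is at least 22 =
  15 + 7, so the period is a multiple of 16 and rigidity applies.\<close>

lemma curling_tm_image_no_repeat: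
  assumes q: "0 < q" and r: "4 * q < 3 * r"
  shows "\<not> repeats (morph curling_block ternary_tm) q a r"
proof
  assume rep: "repeats (morph curling_block ternary_tm) q a r"
  show False
  proof (cases "q < 16")
    case True
    then have "q \<in> set [1..<16]" using q by simp
    then have "\<not> repeats (morph curling_block ternary_tm) q a (Suc (4 * q div 3))"
      using True
      by (intro morph_no_short_repeat[OF squarefree_ternary_tm ternary_tm_in length_blocks(2)
            bspec[OF no_short_repeat_curling]]) simp_all
    moreover have "Suc (4 * q div 3) \<le> r" using r by linarith
    ultimately show False using rep repeats_mono by blast
  next
    case False
    have "synchronized curling_block ternary_tm 2 7"
      by (rule synchronizedI[OF squarefree_ternary_tm ternary_tm_in length_blocks(2) sync_curling])
        simp_all
    then have "16 dvd q"
      by (rule synchronized_period[OF _ _ rep]) (use False r in simp_all)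
    then obtain m where m: "q = 16 * m" by (elim dvdE)
    then have "0 < m" and "64 * m < 3 * r" using q r by simp_all
    then have "16 * m + 6 \<le> r" by (cases "m = 1") linarith+
    with rep have "repeats (morph curling_block ternary_tm) (16 * m) a (16 * m + 6)"
      unfolding m by (rule repeats_mono)
    then show False
      using morph_no_aligned_repeat[OF squarefree_ternary_tm ternary_tm_in length_blocks(2)
          inj_blocks(2) rigid_curling \<open>0 < m\<close>, of a] by contradiction
  qed
qed

theorem theorem10:
  shows "\<exists>w :: nat word. range w \<subseteq> {0, 1, 2} \<and> overlap_free w \<and>
           plus_free (7 / 3) (curling_transform w)"
proof (intro exI conjI)
  have "set (image_block n) \<subseteq> {0, 1, 2}" for n
    by (simp add: image_block_def)
  moreover have "tm_image n \<in> set (image_block (ternary_tm (n div 16)))" for n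
    unfolding morph_def by (rule nth_mem) (simp add: length_blocks)
  ultimately have "tm_image n \<in> {0, 1, 2}" for n by (rule subsetD)
  then show "range tm_image \<subseteq> {0, 1, 2}" by (rule image_subsetI)
  show "overlap_free tm_image"
    by (rule overlap_freeI) (rule tm_image_no_overlap)
  show "plus_free (7 / 3) (curling_transform tm_image)"
    unfolding curling_transform_tm_image
  proof (rule plus_freeI)
    fix q a r :: nat
    assume "0 < q" "(7 / 3 - 1) * real q < real r"
    then have "4 * real q < 3 * real r" by (simp add: field_simps)
    then have "4 * q < 3 * r" by linarith
    then show "\<not> repeats (morph curling_block ternary_tm) q a r"
      using \<open>0 < q\<close> by (rule curling_tm_image_no_repeat[rotated])
  qed
qed

end
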